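(* Let $f : \mathbb{C} \to \mathbb{C}$ be an entire function and let $n \ge 2$ be a fixed integer. Let $D_n(f) \subseteq M_n(\mathbb{C})$ be the set of all matrices whose eigenvalues all lie in $f(\mathbb{C})$. Then $\operatorname{Im}(M_n(f)) \ne D_n(f)$ if and only if there exists $t \in f(\mathbb{C})$ such that $f^{-1}(t) \subseteq Z(f')$.
   Context: For an entire function $f$ with power series $f(z) = \sum_{m=0}^{\infty} a_m z^m$ around $0$, and $A \in M_n(\mathbb{C})$, the matrix $f(A) := \sum_{m=0}^{\infty} a_m A^m$ is well defined (the series converges), and $M_n(f) : M_n(\mathbb{C}) \to M_n(\mathbb{C})$ is the map $A \mapsto f(A)$, with image $\operatorname{Im}(M_n(f))$. $f'$ is the derivative of $f$, $Z(f') = \{z \in \mathbb{C} : f'(z) = 0\}$, and $f^{-1}(t) = \{z \in \mathbb{C} : f(z) = t\}$. *)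

theory Defs
  imports
    "HOL-Complex_Analysis.Complex_Analysis"
    "Jordan_Normal_Form.Jordan_Normal_Form_Existence"
begin

text \<open>
  Matrices of type \<open>complex mat\<close> carry no topology, so the matrix power series is summed entry by
  entry, which is convergence in the finite-dimensional space of \<open>n \<times> n\<close> matrices. The coefficient
  \<open>fps_nth (fps_expansion f 0) m\<close> is \<open>(deriv ^^ m) f 0 / fact m\<close>. For entire \<open>f\<close> every entry
  converges, see \<open>summable_entire_mat\<close> below.
\<close>

definition entire_mat :: "(complex \<Rightarrow> complex) \<Rightarrow> complex mat \<Rightarrow> complex mat" where
  "entire_mat f A = mat (dim_row A) (dim_col A)
     (\<lambda>(i, j). \<Sum>m. fps_nth (fps_expansion f 0) m * (A ^\<^sub>m m) $$ (i, j))"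

definition Im_M :: "nat \<Rightarrow> (complex \<Rightarrow> complex) \<Rightarrow> complex mat set" where
  "Im_M n f = entire_mat f ` carrier_mat n n"

definition D_set :: "nat \<Rightarrow> (complex \<Rightarrow> complex) \<Rightarrow> complex mat set" where
  "D_set n f = {A \<in> carrier_mat n n. \<forall>k. eigenvalue A k \<longrightarrow> k \<in> range f}"

lemma norm_bound_pow_mat:
  fixes A :: "complex mat"
  assumes A: "A \<in> carrier_mat n n" and b: "norm_bound A b" and b0: "b \<ge> 0"
  shows "norm_bound (A ^\<^sub>m m) ((b * of_nat n) ^ m)"
proof (induction m)
  case 0
  show ?case using A by (auto simp: norm_bound_def)
next
  case (Suc m)
  have "norm_bound (A ^\<^sub>m m * A) ((b * of_nat n) ^ m * b * of_nat n)"
    by (rule norm_bound_mult[OF pow_carrier_mat[OF A] A Suc.IH b])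
  then show ?case by (simp add: mult_ac)
qed

lemma summable_entire_mat:
  assumes f: "f holomorphic_on UNIV" and A: "A \<in> carrier_mat n n" and ij: "i < n" "j < n"
  shows "summable (\<lambda>m. fps_nth (fps_expansion f 0) m * (A ^\<^sub>m m) $$ (i, j))"
proof -
  obtain b0 where "norm_bound A b0"
    using norm_bound_max by blast
  then have b: "norm_bound A (max b0 0)"
    unfolding norm_bound_def by fastforce
  define c where "c = max b0 0 * of_nat n"
  have c0: "c \<ge> 0" unfolding c_def by simp
  have "norm (complex_of_real c) < fps_conv_radius (fps_expansion f 0)"
  proof -
    have "fps_conv_radius (fps_expansion f 0) \<ge> \<infinity>"
      by (rule conv_radius_fps_expansion) (use f in auto)
    then show ?thesis by simp
  qed
  then have s: "summable (\<lambda>m. norm (fps_nth (fps_expansion f 0) m * complex_of_real c ^ m))"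
    by (rule norm_summable_fps)
  show ?thesis
  proof (rule summable_comparison_test'[OF s, of 0])
    fix m :: nat
    have "norm ((A ^\<^sub>m m) $$ (i, j)) \<le> c ^ m"
      using norm_bound_pow_mat[OF A b, of m] A ij pow_carrier_mat[OF A, of m]
      unfolding norm_bound_def c_def by auto
    then show "norm (fps_nth (fps_expansion f 0) m * (A ^\<^sub>m m) $$ (i, j))
        \<le> norm (fps_nth (fps_expansion f 0) m * complex_of_real c ^ m)"
      using c0 by (auto simp: norm_mult norm_power intro!: mult_left_mono)
  qed
qed

end

theory Submission
  imports Defs
begin

text \<open>
  The map \<open>A \<mapsto> f(A)\<close> respects intertwining relations \<open>P A = B P\<close>, hence similarity and commutation.
  If \<open>f(a) = t\<close> and \<open>f'(a) \<noteq> 0\<close>, the Taylor series of \<open>f - t\<close> at \<open>a\<close> has a formal compositional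
  inverse \<open>H\<close>, and \<open>f(a + H(N)) = t + N\<close> for the nilpotent Jordan block \<open>N\<close>: every Jordan block with
  eigenvalue \<open>t\<close> is in the image, and block sums and conjugation give all of \<open>D\<^sub>n(f)\<close>. Conversely, if
  \<open>f(A) = t + N\<close>, then \<open>A\<close> commutes with \<open>N\<close>, so \<open>A = a + b N + \<dots>\<close>; the first two entries of the
  top row give \<open>f(a) = t\<close> and \<open>f'(a) b = 1\<close>.
\<close>

section \<open>Entrywise summation of the matrix series and Taylor re-expansion\<close>

lemma index_mult_mat_sum:
  assumes "A \<in> carrier_mat m n" "B \<in> carrier_mat n l" "i < m" "j < l"
  shows "(A * B) $$ (i, j) = (\<Sum>k<n. A $$ (i, k) * B $$ (k, j))"
  using assms by (simp add: scalar_prod_def atLeast0LessThan)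

lemma entire_mat_carrier [simp]:
  "A \<in> carrier_mat n n \<Longrightarrow> entire_mat f A \<in> carrier_mat n n"
  unfolding entire_mat_def by auto

lemma dim_entire_mat [simp]:
  "dim_row (entire_mat f A) = dim_row A" "dim_col (entire_mat f A) = dim_col A"
  unfolding entire_mat_def by auto

lemma entire_mat_sums:
  assumes "f holomorphic_on UNIV" and "A \<in> carrier_mat n n" and "i < n" "j < n"
  shows "(\<lambda>m. fps_nth (fps_expansion f 0) m * (A ^\<^sub>m m) $$ (i, j)) sums entire_mat f A $$ (i, j)"
  using summable_sums[OF summable_entire_mat[OF assms]] assms(2-) by (simp add: entire_mat_def)

lemma entire_mat_index_eq:
  assumes "f holomorphic_on UNIV" and "A \<in> carrier_mat n n" and "i < n" "j < n"
    and "(\<lambda>m. fps_nth (fps_expansion f 0) m * (A ^\<^sub>m m) $$ (i, j)) sums s"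
  shows "entire_mat f A $$ (i, j) = s"
  using sums_unique2[OF entire_mat_sums[OF assms(1-4)] assms(5)] .

text \<open>This is the Taylor series at 0 of the r-th derivative, evaluated at \<open>z\<close> and
  divided by \<open>fact r\<close>. It links the coefficients at 0, by which f(A) is defined, to the
  local expansion at an eigenvalue.\<close>

lemma sums_fps_expansion_shift:
  assumes f: "f holomorphic_on UNIV"
  shows "(\<lambda>m. fps_nth (fps_expansion f 0) m * (of_nat (m choose r) * z ^ (m - r)))
    sums fps_nth (fps_expansion f z) r"
proof -
  have "(deriv ^^ r) f holomorphic_on ball 0 (norm z + 1)"
    using holomorphic_higher_deriv[OF f open_UNIV] by (rule holomorphic_on_subset) simp
  from holomorphic_power_series[OF this, of z]
  have "(\<lambda>m. (deriv ^^ m) ((deriv ^^ r) f) 0 / fact m * z ^ m) sums (deriv ^^ r) f z"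
    by simp
  then have "(\<lambda>m. (deriv ^^ m) ((deriv ^^ r) f) 0 / fact m * z ^ m / fact r)
      sums ((deriv ^^ r) f z / fact r)"
    by (rule sums_divide)
  moreover have "(deriv ^^ m) ((deriv ^^ r) f) 0 / fact m * z ^ m / fact r
    = fps_nth (fps_expansion f 0) (m + r) * (of_nat (m + r choose r) * z ^ (m + r - r))" for m
    by (simp add: fps_expansion_def funpow_add binomial_fact field_simps)
  ultimately have "(\<lambda>m. fps_nth (fps_expansion f 0) (m + r) *
      (of_nat (m + r choose r) * z ^ (m + r - r))) sums fps_nth (fps_expansion f z) r"
    by (simp add: fps_expansion_def)
  \<comment> \<open>Terms with m < r vanish with the binomial coefficient, so the series may start
    at 0 and the truncated \<open>m - r\<close> does no harm.\<close>
  then show ?thesis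
    by (subst (asm) sums_zero_iff_shift) (auto simp: binomial_eq_0)
qed

section \<open>Intertwining and similarity\<close>

text \<open>The relation passes to all powers, and multiplication by \<open>P\<close> is a finite
  sum in each entry, so it commutes with the limit. Similarity is the case of invertible
  \<open>P\<close>; that A commutes with f(A) is the case of one matrix in all three roles.\<close>

lemma entire_mat_intertwine:
  assumes f: "f holomorphic_on UNIV"
    and A: "A \<in> carrier_mat n n" and B: "B \<in> carrier_mat m m" and P: "P \<in> carrier_mat m n"
    and PA: "P * A = B * P"
  shows "P * entire_mat f A = entire_mat f B * P"
proof (rule eq_matI)
  have pow: "P * A ^\<^sub>m k = B ^\<^sub>m k * P" for k
  proof (induction k)
    case 0
    then show ?case using A B P by simp
  next
    case (Suc k)
    have "P * A ^\<^sub>m Suc k = (P * A ^\<^sub>m k) * A"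
      using A P by (simp add: assoc_mult_mat[OF P pow_carrier_mat[OF A] A])
    also have "\<dots> = B ^\<^sub>m k * (P * A)"
      unfolding Suc.IH by (rule assoc_mult_mat[OF pow_carrier_mat[OF B] P A])
    also have "\<dots> = B ^\<^sub>m Suc k * P"
      unfolding PA using B P by (simp add: assoc_mult_mat[OF pow_carrier_mat[OF B] B P])
    finally show ?case .
  qed
  fix i j assume "i < dim_row (entire_mat f B * P)" "j < dim_col (entire_mat f B * P)"
  then have i: "i < m" and j: "j < n" using B P by auto
  let ?c = "fps_nth (fps_expansion f 0)"
  have "(\<lambda>k. \<Sum>l<n. P $$ (i, l) * (?c k * (A ^\<^sub>m k) $$ (l, j)))
      sums (\<Sum>l<n. P $$ (i, l) * entire_mat f A $$ (l, j))"
    by (intro sums_sum sums_mult entire_mat_sums[OF f A]) (use j in auto)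
  moreover have "(\<Sum>l<n. P $$ (i, l) * (?c k * (A ^\<^sub>m k) $$ (l, j)))
      = ?c k * (P * A ^\<^sub>m k) $$ (i, j)" for k
    using i j A P by (simp add: scalar_prod_def sum_distrib_left atLeast0LessThan mult_ac)
  moreover have "(\<Sum>l<n. P $$ (i, l) * entire_mat f A $$ (l, j)) = (P * entire_mat f A) $$ (i, j)"
    using i j A P by (simp add: scalar_prod_def atLeast0LessThan)
  ultimately have 1: "(\<lambda>k. ?c k * (P * A ^\<^sub>m k) $$ (i, j)) sums (P * entire_mat f A) $$ (i, j)"
    by simp
  have "(\<lambda>k. \<Sum>l<m. (?c k * (B ^\<^sub>m k) $$ (i, l)) * P $$ (l, j))
      sums (\<Sum>l<m. entire_mat f B $$ (i, l) * P $$ (l, j))"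
    by (intro sums_sum sums_mult2 entire_mat_sums[OF f B]) (use i in auto)
  moreover have "(\<Sum>l<m. (?c k * (B ^\<^sub>m k) $$ (i, l)) * P $$ (l, j))
      = ?c k * (B ^\<^sub>m k * P) $$ (i, j)" for k
    using i j B P by (simp add: scalar_prod_def sum_distrib_left atLeast0LessThan mult_ac)
  moreover have "(\<Sum>l<m. entire_mat f B $$ (i, l) * P $$ (l, j)) = (entire_mat f B * P) $$ (i, j)"
    using i j B P by (simp add: scalar_prod_def atLeast0LessThan)
  ultimately have 2: "(\<lambda>k. ?c k * (B ^\<^sub>m k * P) $$ (i, j)) sums (entire_mat f B * P) $$ (i, j)"
    by simp
  show "(P * entire_mat f A) $$ (i, j) = (entire_mat f B * P) $$ (i, j)"
    using sums_unique2[OF 1[unfolded pow] 2] .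
qed (use A B P in auto)

lemma similar_mat_wit_entire_mat:
  assumes f: "f holomorphic_on UNIV" and sim: "similar_mat_wit A B P Q"
  shows "similar_mat_wit (entire_mat f A) (entire_mat f B) P Q"
proof -
  define n where "n = dim_row A"
  note w = similar_mat_witD[OF n_def sim]
  have "A * P = P * B * (Q * P)"
    unfolding w(3) using w by (intro assoc_mult_mat) auto
  then have "P * B = A * P" using w by simp
  then have *: "P * entire_mat f B = entire_mat f A * P"
    by (rule entire_mat_intertwine[OF f w(5) w(4) w(6)])
  have "P * entire_mat f B * Q = entire_mat f A * (P * Q)"
    unfolding * using w by (intro assoc_mult_mat) auto
  then have "entire_mat f A = P * entire_mat f B * Q" using w by simp
  then show ?thesis using w by (intro similar_mat_witI[of _ _ n]) auto
qed

section \<open>Triangular matrices and the spectrum of f(A)\<close>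

lemma upper_triangular_pow_mat:
  fixes A :: "'a :: semiring_1 mat"
  assumes A: "A \<in> carrier_mat n n" and ut: "upper_triangular A"
  shows "upper_triangular (A ^\<^sub>m k) \<and> (\<forall>i<n. (A ^\<^sub>m k) $$ (i, i) = A $$ (i, i) ^ k)"
proof (induction k)
  case 0
  then show ?case using A by auto
next
  case (Suc k)
  note Ak = pow_carrier_mat[OF A, of k]
  have *: "(A ^\<^sub>m Suc k) $$ (i, j) = (if j = i then A $$ (i, i) ^ Suc k else 0)"
    if "i < n" "j \<le> i" for i j
  proof -
    have "(A ^\<^sub>m Suc k) $$ (i, j) = (\<Sum>l<n. (A ^\<^sub>m k) $$ (i, l) * A $$ (l, j))"
      using A Ak that by (simp add: scalar_prod_def atLeast0LessThan)
    also have "\<dots> = (\<Sum>l<n. if l = i \<and> j = i then A $$ (i, i) ^ Suc k else 0)"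
    proof (intro sum.cong refl)
      fix l assume l: "l \<in> {..<n}"
      \<comment> \<open>For l < i the left factor vanishes by induction; for l > i the right one
        does, since j \<le> i < l. Only l = i can contribute.\<close>
      consider "l < i" | "l = i" | "l > i" by linarith
      then show "(A ^\<^sub>m k) $$ (i, l) * A $$ (l, j)
          = (if l = i \<and> j = i then A $$ (i, i) ^ Suc k else 0)"
        using Suc.IH ut A Ak l that upper_triangularD[of A j l]
          upper_triangularD[of "A ^\<^sub>m k" l i]
        by cases (auto simp: power_commutes)
    qed
    also have "\<dots> = (if j = i then A $$ (i, i) ^ Suc k else 0)"
      using that by (cases "j = i") auto
    finally show ?thesis .
  qed
  then show ?case using A by (auto simp del: pow_mat.simps)
qed

lemma entire_mat_upper_triangular:
  assumes f: "f holomorphic_on UNIV" and A: "A \<in> carrier_mat n n" and ut: "upper_triangular A"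
  shows "upper_triangular (entire_mat f A)"
    and "i < n \<Longrightarrow> entire_mat f A $$ (i, i) = f (A $$ (i, i))"
proof -
  note pow = upper_triangular_pow_mat[OF A ut]
  show "upper_triangular (entire_mat f A)"
  proof
    fix i j assume "j < i" "i < dim_row (entire_mat f A)"
    then have ij: "i < n" "j < n" "j < i" using A by auto
    have "(A ^\<^sub>m m) $$ (i, j) = 0" for m
      using pow[of m] ij A by (auto intro!: upper_triangularD)
    then show "entire_mat f A $$ (i, j) = 0"
      by (intro entire_mat_index_eq[OF f A ij(1,2)]) simp
  qed
  assume i: "i < n"
  show "entire_mat f A $$ (i, i) = f (A $$ (i, i))"
    \<comment> \<open>The case r = 0 is the Taylor series of f about 0, here summed at the diagonal
      entry.\<close>
    using sums_fps_expansion_shift[OF f, of 0 "A $$ (i, i)"] pow i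
    by (intro entire_mat_index_eq[OF f A i i]) (simp add: fps_expansion_def)
qed

text \<open>By Schur triangularization f(A) is similar to f(T) with T upper triangular, and the
  eigenvalues of f(T) are the values of f on the diagonal of T.\<close>

lemma Im_M_subset_D_set:
  assumes f: "f holomorphic_on UNIV"
  shows "Im_M n f \<subseteq> D_set n f"
proof
  fix B assume "B \<in> Im_M n f"
  then obtain A where A: "A \<in> carrier_mat n n" and B: "B = entire_mat f A"
    unfolding Im_M_def by auto
  obtain as where "char_poly A = (\<Prod>a\<leftarrow>as. [:- a, 1:])"
    using char_poly_factorized[OF A] by auto
  from schur_decomposition_exists[OF A this] obtain T P Q where
    T: "T \<in> carrier_mat n n" "upper_triangular T" and sim: "similar_mat_wit A T P Q"
    unfolding similar_mat_def by blast
  have "char_poly B = char_poly (entire_mat f T)"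
    using similar_mat_wit_entire_mat[OF f sim] unfolding B
    by (intro char_poly_similar) (auto simp: similar_mat_def)
  also have "\<dots> = (\<Prod>a \<leftarrow> diag_mat (entire_mat f T). [:- a, 1:])"
    by (intro char_poly_upper_triangular[of _ n] entire_mat_upper_triangular[OF f T]) (use T in auto)
  finally have *: "char_poly B = (\<Prod>a \<leftarrow> diag_mat (entire_mat f T). [:- a, 1:])" .
  have Bc: "B \<in> carrier_mat n n" using A B by simp
  have "k \<in> range f" if "eigenvalue B k" for k
  proof -
    from that have "poly (char_poly B) k = 0" using eigenvalue_root_char_poly[OF Bc] by simp
    then have "k \<in> set (diag_mat (entire_mat f T))"
      unfolding * by (auto simp: poly_prod_list prod_list_zero_iff)
    then show ?thesis
      using T entire_mat_upper_triangular(2)[OF f T] by (auto simp: diag_mat_def)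
  qed
  then show "B \<in> D_set n f" using Bc unfolding D_set_def by auto
qed

section \<open>Toeplitz matrices as truncated formal power series\<close>

text \<open>
  The value of \<open>F\<close> at the nilpotent Jordan block of size \<open>n\<close>.
\<close>
definition fps_mat :: "nat \<Rightarrow> 'a :: comm_ring_1 fps \<Rightarrow> 'a mat" where
  "fps_mat n F = mat n n (\<lambda>(i, j). if i \<le> j then fps_nth F (j - i) else 0)"

lemma fps_mat_carrier [simp]: "fps_mat n F \<in> carrier_mat n n"
  and dim_fps_mat [simp]: "dim_row (fps_mat n F) = n" "dim_col (fps_mat n F) = n"
  by (auto simp: fps_mat_def)

text \<open>In entry (i, j) only the indices from i to j contribute, and in terms of offsets the sum
  is a Cauchy product. Matrix computations thereby become computations with power series.\<close>

lemma fps_mat_mult: "fps_mat n F * fps_mat n G = fps_mat n (F * G)"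
proof (rule eq_matI)
  fix i j assume "i < dim_row (fps_mat n (F * G))" "j < dim_col (fps_mat n (F * G))"
  then have ij: "i < n" "j < n" by auto
  let ?t = "\<lambda>k. (if i \<le> k then fps_nth F (k - i) else 0) * (if k \<le> j then fps_nth G (j - k) else 0)"
  have "(fps_mat n F * fps_mat n G) $$ (i, j) = (\<Sum>k\<in>{0..<n}. ?t k)"
    using ij by (simp add: scalar_prod_def fps_mat_def)
  also have "\<dots> = (\<Sum>k\<in>{i..j}. ?t k)"
    using ij by (intro sum.mono_neutral_right) auto
  also have "\<dots> = fps_mat n (F * G) $$ (i, j)"
  proof (cases "i \<le> j")
    case True
    then have "(\<Sum>k\<in>{i..j}. ?t k) = (\<Sum>k=0..j - i. fps_nth F k * fps_nth G (j - i - k))"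
      by (intro sum.reindex_bij_witness[of _ "\<lambda>k. k + i" "\<lambda>k. k - i"]) auto
    then show ?thesis using ij True by (simp add: fps_mat_def fps_mult_nth)
  qed (use ij in \<open>simp add: fps_mat_def\<close>)
  finally show "(fps_mat n F * fps_mat n G) $$ (i, j) = fps_mat n (F * G) $$ (i, j)" .
qed auto

lemma fps_mat_pow: "fps_mat n F ^\<^sub>m k = fps_mat n (F ^ k)"
proof (induction k)
  case 0
  show ?case by (rule eq_matI) (auto simp: fps_mat_def)
qed (simp add: fps_mat_mult power_commutes)

text \<open>The binomial theorem, with a range of r that depends on l instead of m: over such a
  fixed finite range the series in m can be summed term by term.\<close>

lemma fps_nth_power_const_add:
  fixes H :: "'a :: comm_ring_1 fps"
  assumes H0: "fps_nth H 0 = 0"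
  shows "fps_nth ((fps_const a + H) ^ m) l
    = (\<Sum>r=0..l. of_nat (m choose r) * a ^ (m - r) * fps_nth (H ^ r) l)"
proof -
  let ?t = "\<lambda>r. of_nat (m choose r) * a ^ (m - r) * fps_nth (H ^ r) l"
  have "(fps_const a + H) ^ m = (\<Sum>r\<le>m. fps_const (of_nat (m choose r) * a ^ (m - r)) * H ^ r)"
    by (subst add.commute, subst binomial_ring)
      (simp add: fps_const_mult[symmetric] fps_of_nat mult_ac del: fps_const_mult)
  then have "fps_nth ((fps_const a + H) ^ m) l = (\<Sum>r\<le>m. ?t r)"
    by (simp add: fps_sum_nth)
  \<comment> \<open>The range is cut at l because \<open>H ^ r\<close> has no terms below degree r,
    and then extended past m, where the binomial coefficients are 0.\<close>
  also have "\<dots> = (\<Sum>r\<in>{..m} \<inter> {0..l}. ?t r)"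
    using startsby_zero_power_prefix[OF H0] by (intro sum.mono_neutral_right) auto
  also have "\<dots> = (\<Sum>r=0..l. ?t r)"
    by (intro sum.mono_neutral_left) (auto simp: binomial_eq_0)
  finally show ?thesis .
qed

text \<open>Summing over m first, at fixed r, gives the r-th Taylor coefficient of f at
  \<open>a\<close>; the finite sum over r that remains is a coefficient of the composition.\<close>

lemma entire_mat_fps_mat:
  assumes f: "f holomorphic_on UNIV" and H0: "fps_nth H 0 = 0"
  shows "entire_mat f (fps_mat n (fps_const a + H))
    = fps_mat n (fps_compose (fps_expansion f a) H)"
proof (rule eq_matI)
  let ?c = "fps_nth (fps_expansion f 0)" and ?G = "fps_const a + H"
  fix i j assume "i < dim_row (fps_mat n (fps_compose (fps_expansion f a) H))"
    "j < dim_col (fps_mat n (fps_compose (fps_expansion f a) H))"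
  then have ij: "i < n" "j < n" by auto
  define l where "l = j - i"
  have "(\<lambda>m. \<Sum>r=0..l. ?c m * (of_nat (m choose r) * a ^ (m - r)) * fps_nth (H ^ r) l)
      sums (\<Sum>r=0..l. fps_nth (fps_expansion f a) r * fps_nth (H ^ r) l)"
    by (intro sums_sum sums_mult2 sums_fps_expansion_shift[OF f])
  then have *: "(\<lambda>m. ?c m * fps_nth (?G ^ m) l) sums fps_nth (fps_compose (fps_expansion f a) H) l"
    by (simp add: fps_nth_power_const_add[OF H0] fps_compose_nth sum_distrib_left mult_ac)
  show "entire_mat f (fps_mat n ?G) $$ (i, j)
      = fps_mat n (fps_compose (fps_expansion f a) H) $$ (i, j)"
    using * ij by (intro entire_mat_index_eq[OF f _ ij])
      (simp_all add: fps_mat_pow, simp add: fps_mat_def l_def)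
qed auto

lemma jordan_block_eq_fps_mat: "jordan_block n t = fps_mat n (fps_const t + fps_X)"
  by (rule eq_matI) (auto simp: fps_mat_def)

lemma jordan_block_in_range_entire_mat:
  assumes f: "f holomorphic_on UNIV" and nz: "deriv f a \<noteq> 0"
  shows "\<exists>A \<in> carrier_mat n n. entire_mat f A = jordan_block n (f a)"
proof -
  let ?F = "fps_expansion f a"
  define F where "F = ?F - fps_const (f a)"
  \<comment> \<open>The inverse is purely formal: \<open>fps_mat n\<close> reads only coefficients
    of degree below n, so no convergence of \<open>H\<close> enters.\<close>
  define H where "H = fps_inv F"
  have F: "fps_nth F 0 = 0" "fps_nth F 1 \<noteq> 0"
    using nz by (auto simp: F_def fps_expansion_def)
  have H0: "fps_nth H 0 = 0" by (simp add: H_def fps_inv_def)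
  have "fps_compose ?F H - fps_const (f a) = fps_X"
    using fps_inv_right[OF F] unfolding H_def[symmetric]
    by (simp add: F_def fps_compose_sub_distrib)
  then have "fps_compose ?F H = fps_const (f a) + fps_X" by (simp add: algebra_simps)
  then have "entire_mat f (fps_mat n (fps_const a + H)) = jordan_block n (f a)"
    by (simp add: entire_mat_fps_mat[OF f H0] jordan_block_eq_fps_mat)
  then show ?thesis using fps_mat_carrier by blast
qed

section \<open>Block sums and the inclusion of D_n(f) in the image\<close>

lemma entire_mat_four_block_diag:
  assumes f: "f holomorphic_on UNIV" and A: "A \<in> carrier_mat n n" and B: "B \<in> carrier_mat m m"
  shows "entire_mat f (four_block_mat A (0\<^sub>m n m) (0\<^sub>m m n) B)
    = four_block_mat (entire_mat f A) (0\<^sub>m n m) (0\<^sub>m m n) (entire_mat f B)"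
    (is "entire_mat f ?L = ?R")
proof (rule eq_matI)
  fix i j assume "i < dim_row ?R" "j < dim_col ?R"
  then have ij: "i < n + m" "j < n + m" using A B by auto
  have L: "?L \<in> carrier_mat (n + m) (n + m)" using A B by simp
  have Ak: "dim_row (A ^\<^sub>m k) = n" "dim_col (A ^\<^sub>m k) = n" for k
    using pow_carrier_mat[OF A, of k] by auto
  have Bk: "dim_row (B ^\<^sub>m k) = m" "dim_col (B ^\<^sub>m k) = m" for k
    using pow_carrier_mat[OF B, of k] by auto
  show "entire_mat f ?L $$ (i, j) = ?R $$ (i, j)"
  proof (rule entire_mat_index_eq[OF f L ij])
    show "(\<lambda>k. fps_nth (fps_expansion f 0) k * (?L ^\<^sub>m k) $$ (i, j)) sums ?R $$ (i, j)"
      unfolding pow_four_block_mat[OF A B]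
      using ij A B Ak Bk entire_mat_sums[OF f A, of i j]
        entire_mat_sums[OF f B, of "i - n" "j - n"]
      by (cases "i < n"; cases "j < n") (simp_all add: Ak Bk del: pow_mat_dim)
  qed
qed (use A B in auto)

text \<open>Since f acts separately on the blocks of a block sum, each Jordan block can use its own
  noncritical point over its eigenvalue.\<close>

lemma jordan_matrix_in_range_entire_mat:
  assumes f: "f holomorphic_on UNIV"
    and "\<And>t. t \<in> snd ` set ks \<Longrightarrow> \<exists>a. f a = t \<and> deriv f a \<noteq> 0"
  shows "\<exists>A \<in> carrier_mat (sum_list (map fst ks)) (sum_list (map fst ks)).
    entire_mat f A = jordan_matrix ks"
  using assms(2)
proof (induction ks)
  case Nil
  show ?case
    by (rule bexI[of _ "0\<^sub>m 0 0"], rule eq_matI) (auto simp: jordan_matrix_def)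
next
  case (Cons kt ks)
  obtain k t where kt: "kt = (k, t)" by force
  let ?m = "sum_list (map fst ks)"
  have "\<exists>a. f a = s \<and> deriv f a \<noteq> 0" if "s \<in> snd ` set ks" for s
    using Cons.prems that by auto
  from Cons.IH[OF this] obtain B where
    B: "B \<in> carrier_mat ?m ?m" "entire_mat f B = jordan_matrix ks" by blast
  obtain a where a: "f a = t" "deriv f a \<noteq> 0" using Cons.prems[of t] kt by auto
  obtain A where A: "A \<in> carrier_mat k k" "entire_mat f A = jordan_block k t"
    using jordan_block_in_range_entire_mat[OF f a(2), of k] a by auto
  show ?case
    using entire_mat_four_block_diag[OF f A(1) B(1)] A B unfolding kt jordan_matrix_Cons
    by (intro bexI[of _ "four_block_mat A (0\<^sub>m k ?m) (0\<^sub>m ?m k) B"]) auto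
qed

lemma D_set_subset_Im_M:
  assumes f: "f holomorphic_on UNIV"
    and reg: "\<And>t. t \<in> range f \<Longrightarrow> \<exists>a. f a = t \<and> deriv f a \<noteq> 0"
  shows "D_set n f \<subseteq> Im_M n f"
proof
  fix B assume "B \<in> D_set n f"
  then have B: "B \<in> carrier_mat n n" and ev: "\<And>k. eigenvalue B k \<Longrightarrow> k \<in> range f"
    unfolding D_set_def by auto
  obtain as where "char_poly B = (\<Prod>a\<leftarrow>as. [:- a, 1:])"
    using char_poly_factorized[OF B] by auto
  from jordan_nf_exists[OF B this] obtain ks where jnf: "jordan_nf B ks" by blast
  then obtain P Q where sim: "similar_mat_wit B (jordan_matrix ks) P Q"
    and ks0: "0 \<notin> fst ` set ks"
    unfolding jordan_nf_def similar_mat_def by blast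
  note w = similar_mat_witD2[OF B sim]
  have n: "n = sum_list (map fst ks)" using w(5) jordan_matrix_dim(1)[of ks] by auto
  \<comment> \<open>Jordan blocks have positive size, so each listed \<open>t\<close> is a root of
    the characteristic polynomial, hence an eigenvalue of \<open>B\<close> and a value of f.\<close>
  have "\<exists>a. f a = t \<and> deriv f a \<noteq> 0" if "t \<in> snd ` set ks" for t
  proof -
    from that obtain k where kt: "(k, t) \<in> set ks" by auto
    have "k \<noteq> 0" using ks0 kt by force
    then have "poly (char_poly B) t = 0"
      unfolding jordan_nf_char_poly[OF jnf] using kt
      by (force simp: poly_prod_list prod_list_zero_iff)
    then show ?thesis using eigenvalue_root_char_poly[OF B] ev reg by blast
  qed
  from jordan_matrix_in_range_entire_mat[OF f this] obtain A where
    A: "A \<in> carrier_mat n n" "entire_mat f A = jordan_matrix ks" unfolding n by blast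
  \<comment> \<open>A preimage of the Jordan form is carried back to a preimage of \<open>B\<close>
    by the same conjugation.\<close>
  have "similar_mat_wit (P * A * Q) A P Q"
    using w A by (intro similar_mat_witI[of _ _ n]) auto
  from similar_mat_wit_entire_mat[OF f this] have "entire_mat f (P * A * Q) = P * entire_mat f A * Q"
    by (rule similar_mat_witD(3)[OF refl])
  then have "B = entire_mat f (P * A * Q)" using w(3) A by simp
  then show "B \<in> Im_M n f" using A w unfolding Im_M_def by auto
qed

section \<open>The commutant of a Jordan block and the obstruction\<close>

text \<open>The multiples of t cancel. The nilpotent part shifts columns to the right in one product
  and rows upwards in the other; comparing the first two columns gives the claims.\<close>

lemma commutes_jordan_block_index:
  fixes A :: "'a :: field mat"
  assumes A: "A \<in> carrier_mat n n" and n: "n \<ge> 2"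
    and comm: "A * jordan_block n t = jordan_block n t * A"
  shows "i < n \<Longrightarrow> 0 < i \<Longrightarrow> A $$ (i, 0) = 0" and "i < n \<Longrightarrow> 1 < i \<Longrightarrow> A $$ (i, 1) = 0"
    and "A $$ (1, 1) = A $$ (0, 0)"
proof -
  let ?J = "jordan_block n t"
  have AJ0: "(A * ?J) $$ (i, 0) = A $$ (i, 0) * t" if "i < n" for i
  proof -
    have "(A * ?J) $$ (i, 0) = (\<Sum>k<n. A $$ (i, k) * ?J $$ (k, 0))"
      using that n by (intro index_mult_mat_sum[OF A jordan_block_carrier]) auto
    also have "\<dots> = (\<Sum>k<n. if k = 0 then A $$ (i, 0) * t else 0)"
      using n by (intro sum.cong) auto
    finally show ?thesis using n by simp
  qed
  have AJ1: "(A * ?J) $$ (i, 1) = A $$ (i, 1) * t + A $$ (i, 0)" if "i < n" for i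
  proof -
    have "(A * ?J) $$ (i, 1) = (\<Sum>k<n. A $$ (i, k) * ?J $$ (k, 1))"
      using that n by (intro index_mult_mat_sum[OF A jordan_block_carrier]) auto
    also have "\<dots> = (\<Sum>k<n. (if k = 1 then A $$ (i, 1) * t else 0)
        + (if k = 0 then A $$ (i, 0) else 0))"
      using n by (intro sum.cong) auto
    finally show ?thesis using n by (simp add: sum.distrib)
  qed
  have JA: "(?J * A) $$ (i, j) = t * A $$ (i, j) + A $$ (Suc i, j)" if "Suc i < n" "j < n" for i j
  proof -
    have "(?J * A) $$ (i, j) = (\<Sum>k<n. ?J $$ (i, k) * A $$ (k, j))"
      using that by (intro index_mult_mat_sum[OF jordan_block_carrier A]) auto
    also have "\<dots> = (\<Sum>k<n. (if k = i then t * A $$ (i, j) else 0)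
        + (if k = Suc i then A $$ (Suc i, j) else 0))"
      using that by (intro sum.cong) auto
    finally show ?thesis using that by (simp add: sum.distrib)
  qed
  have col0: "A $$ (Suc i, 0) = 0" if "Suc i < n" for i
    using AJ0[of i] JA[of i 0] that unfolding comm by simp
  then show "i < n \<Longrightarrow> 0 < i \<Longrightarrow> A $$ (i, 0) = 0" by (cases i) auto
  have col1: "A $$ (Suc i, 1) = A $$ (i, 0)" if "Suc i < n" for i
    using AJ1[of i] JA[of i 1] that unfolding comm by simp
  then show "A $$ (1, 1) = A $$ (0, 0)" using n by force
  \<comment> \<open>The shift relation moves the entry to (i - 1, 0), which lies below the diagonal
    in column 0.\<close>
  show "A $$ (i, 1) = 0" if "i < n" "1 < i"
    using col1[of "i - 1"] col0[of "i - 2"] that by (simp add: numeral_2_eq_2 Suc_diff_Suc)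
qed

text \<open>The two top left entries multiply like dual numbers: (a + b e)^m = a^m + m a^(m-1) b e
  with e^2 = 0. This is how the derivative of f appears.\<close>

lemma pow_mat_index_01:
  fixes A :: "'a :: comm_ring_1 mat"
  assumes A: "A \<in> carrier_mat n n" and n: "n \<ge> 2"
    and col0: "\<And>i. i < n \<Longrightarrow> 0 < i \<Longrightarrow> A $$ (i, 0) = 0"
    and col1: "\<And>i. i < n \<Longrightarrow> 1 < i \<Longrightarrow> A $$ (i, 1) = 0"
    and diag: "A $$ (1, 1) = A $$ (0, 0)"
  shows "(A ^\<^sub>m m) $$ (0, 0) = A $$ (0, 0) ^ m \<and>
    (A ^\<^sub>m m) $$ (0, 1) = of_nat m * A $$ (0, 0) ^ (m - 1) * A $$ (0, 1)"
proof (induction m)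
  case 0
  show ?case using A n by simp
next
  case (Suc m)
  note Am = pow_carrier_mat[OF A, of m]
  have "(A ^\<^sub>m Suc m) $$ (0, 0) = (\<Sum>k<n. (A ^\<^sub>m m) $$ (0, k) * A $$ (k, 0))"
    using n by (simp add: index_mult_mat_sum[OF Am A] del: index_mult_mat)
  also have "\<dots> = (\<Sum>k<n. if k = 0 then (A ^\<^sub>m m) $$ (0, 0) * A $$ (0, 0) else 0)"
    by (intro sum.cong) (use col0 in auto)
  finally have 0: "(A ^\<^sub>m Suc m) $$ (0, 0) = (A ^\<^sub>m m) $$ (0, 0) * A $$ (0, 0)"
    using n by simp
  have "(A ^\<^sub>m Suc m) $$ (0, 1) = (\<Sum>k<n. (A ^\<^sub>m m) $$ (0, k) * A $$ (k, 1))"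
    using n by (simp add: index_mult_mat_sum[OF Am A] del: index_mult_mat)
  also have "\<dots> = (\<Sum>k<n. (if k = 0 then (A ^\<^sub>m m) $$ (0, 0) * A $$ (0, 1) else 0)
      + (if k = 1 then (A ^\<^sub>m m) $$ (0, 1) * A $$ (1, 1) else 0))"
  proof (intro sum.cong refl)
    fix k assume k: "k \<in> {..<n}"
    consider "k = 0" | "k = 1" | "1 < k" by linarith
    then show "(A ^\<^sub>m m) $$ (0, k) * A $$ (k, 1)
      = (if k = 0 then (A ^\<^sub>m m) $$ (0, 0) * A $$ (0, 1) else 0)
        + (if k = 1 then (A ^\<^sub>m m) $$ (0, 1) * A $$ (1, 1) else 0)"
      using k col1[of k] by cases auto
  qed
  finally have "(A ^\<^sub>m Suc m) $$ (0, 1)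
      = (A ^\<^sub>m m) $$ (0, 0) * A $$ (0, 1) + (A ^\<^sub>m m) $$ (0, 1) * A $$ (0, 0)"
    using n diag by (simp add: sum.distrib)
  \<comment> \<open>The split on \<open>m\<close> settles the truncated exponent
    \<open>m - 1\<close>.\<close>
  with 0 Suc.IH show ?case
    by (cases m) (simp_all add: algebra_simps del: pow_mat.simps)
qed

lemma entire_mat_eq_jordan_blockD:
  assumes f: "f holomorphic_on UNIV" and A: "A \<in> carrier_mat n n" and n: "n \<ge> 2"
    and eq: "entire_mat f A = jordan_block n t"
  shows "\<exists>a. f a = t \<and> deriv f a \<noteq> 0"
proof -
  have "A * entire_mat f A = entire_mat f A * A"
    by (rule entire_mat_intertwine[OF f A A A refl])
  then have comm: "A * jordan_block n t = jordan_block n t * A" unfolding eq .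
  note pow = pow_mat_index_01[OF A n commutes_jordan_block_index[OF A n comm]]
  define a b where "a = A $$ (0, 0)" and "b = A $$ (0, 1)"
  have "entire_mat f A $$ (0, 0) = f a"
    using n sums_fps_expansion_shift[OF f, of 0 a] pow
    by (intro entire_mat_index_eq[OF f A]) (auto simp: a_def fps_expansion_def)
  moreover have "entire_mat f A $$ (0, 1) = deriv f a * b"
    \<comment> \<open>The case r = 1 sums m a^(m-1) against the coefficients of f, which gives
      f'(a).\<close>
    using n sums_mult2[OF sums_fps_expansion_shift[OF f, of 1 a], of b] pow
    by (intro entire_mat_index_eq[OF f A]) (auto simp: a_def b_def fps_expansion_def mult_ac)
  \<comment> \<open>As n is at least 2, the block has an entry (0, 1); it equals 1, which excludes
    f'(a) = 0.\<close>
  ultimately have "f a = t" "deriv f a * b = 1" using n unfolding eq by auto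
  then show ?thesis by auto
qed

theorem theorem2:
  fixes f :: "complex \<Rightarrow> complex" and n :: nat
  assumes "f holomorphic_on UNIV" and "n \<ge> 2"
  shows "Im_M n f \<noteq> D_set n f \<longleftrightarrow>
    (\<exists>t \<in> range f. f -` {t} \<subseteq> {z. deriv f z = 0})"
proof
  assume "Im_M n f \<noteq> D_set n f"
  \<comment> \<open>One inclusion always holds, so the other one fails, and by contraposition some
    value of f has only critical preimages.\<close>
  then have "\<not> D_set n f \<subseteq> Im_M n f" using Im_M_subset_D_set[OF assms(1)] by blast
  then obtain t where "t \<in> range f" "\<nexists>a. f a = t \<and> deriv f a \<noteq> 0"
    using D_set_subset_Im_M[OF assms(1)] by blast
  then show "\<exists>t \<in> range f. f -` {t} \<subseteq> {z. deriv f z = 0}" by auto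
next
  assume "\<exists>t \<in> range f. f -` {t} \<subseteq> {z. deriv f z = 0}"
  then obtain t where t: "t \<in> range f" and crit: "f -` {t} \<subseteq> {z. deriv f z = 0}" by blast
  \<comment> \<open>The separating matrix is the full-size Jordan block: t is its only eigenvalue,
    but a preimage of it would yield a noncritical point over t.\<close>
  let ?J = "jordan_block n t"
  have "k = t" if "eigenvalue ?J k" for k
    using that by (simp add: eigenvalue_root_char_poly[OF jordan_block_carrier]
        jordan_block_char_poly split: if_splits)
  then have "?J \<in> D_set n f" using t unfolding D_set_def by auto
  moreover have "?J \<notin> Im_M n f"
  proof
    assume "?J \<in> Im_M n f"
    then obtain A where "A \<in> carrier_mat n n" "entire_mat f A = ?J" unfolding Im_M_def by auto
    from entire_mat_eq_jordan_blockD[OF assms(1) this(1) assms(2) this(2)] show False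
      using crit by auto
  qed
  ultimately show "Im_M n f \<noteq> D_set n f" by blast
qed

end
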